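(* For every location profile $\mathbf x$, the edge $(a^*,b^* )$ given by $$(a^*,b^* )=\begin{cases}\left(\dfrac{x_l+x_r}{2},\ \dfrac{y_l-x_l}{2}+\dfrac12\right) & \text{if } 1-y_r\ge x_l,\\[2mm] \left(\dfrac{x_r-y_r}{2}+\dfrac12,\ \dfrac{y_l+y_r}{2}\right) & \text{if } 1-y_r<x_l,\end{cases}$$ is the unique optimal solution for the maximum cost, i.e. the unique edge minimizing $MC(a,b,\mathbf x)$. In addition, the optimal maximum cost is attained by both the agents located at $x_r$ and $y_l$, i.e. $MC(a^*,b^*,\mathbf x)=cost(a^*,b^*,x_r)=cost(a^*,b^*,y_l)$.
   Context: Setting. Fix a constant $k\in[0,1)$ and an obstacle $[o,o+L]$ with $o\in(0,1)$ and $0\le L<1-o$. Agents $N=\{1,\ldots,n\}$ have locations $x_i\in[0,o)\cup(o+L,1]$; $N_1=\{i: x_i<o\}$ and $N_2=\{i: x_i>o+L\}$, both nonempty. An edge is a pair $(a,b)$ with $a\in[0,o)$, $b\in(o+L,1]$. The cost of agent $i\in N_1$ is $cost(a,b,x_i)=|x_i-a|+k(b-a)+(1-b)$; the cost of agent $i\in N_2$ is $cost(a,b,x_i)=|x_i-b|+k(b-a)+a$. The maximum cost is $MC(a,b,\mathbf x)=\max_{i\in N}cost(a,b,x_i)$. Write $x_l=\min\{x_i: i\in N_1\}$, $x_r=\max\{x_i: i\in N_1\}$, $y_l=\min\{x_j: j\in N_2\}$, $y_r=\max\{x_j: j\in N_2\}$.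
   Formalization: Uniqueness of the optimal edge is stated only for k > 0, since it fails for k = 0 (obstacle {1/2}, agents at 1/5 and 7/10: edges (1/5, 3/4) and (1/10, 17/20) both attain 1/4); optimality and the two cost equalities are stated for all k in [0,1). *)

theory Defs
  imports Complex_Main
begin

text \<open>
  The obstacle is the interval \<open>[ob, ob + L]\<close>. Agents are the numbers \<open>1..n\<close>, and agent \<open>i\<close> is
  located at \<open>x i\<close>; values of \<open>x\<close> outside \<open>{1..n}\<close> are irrelevant.
\<close>

definition N1 :: "real \<Rightarrow> nat \<Rightarrow> (nat \<Rightarrow> real) \<Rightarrow> nat set" where
  "N1 ob n x = {i \<in> {1..n}. x i < ob}"

definition N2 :: "real \<Rightarrow> real \<Rightarrow> nat \<Rightarrow> (nat \<Rightarrow> real) \<Rightarrow> nat set" where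
  "N2 ob L n x = {i \<in> {1..n}. x i > ob + L}"

definition location_profile :: "real \<Rightarrow> real \<Rightarrow> nat \<Rightarrow> (nat \<Rightarrow> real) \<Rightarrow> bool" where
  "location_profile ob L n x \<longleftrightarrow>
     (\<forall>i \<in> {1..n}. x i \<in> {0..<ob} \<union> {ob + L<..1}) \<and> N1 ob n x \<noteq> {} \<and> N2 ob L n x \<noteq> {}"

definition edges :: "real \<Rightarrow> real \<Rightarrow> (real \<times> real) set" where
  "edges ob L = {0..<ob} \<times> {ob + L<..1}"

text \<open>
  The second branch is meant for locations \<open>z > ob + L\<close>; no agent is located on the obstacle.
\<close>

definition cost :: "real \<Rightarrow> real \<Rightarrow> real \<Rightarrow> real \<Rightarrow> real \<Rightarrow> real" where
  "cost ob k a b z =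
     (if z < ob then \<bar>z - a\<bar> + k * (b - a) + (1 - b) else \<bar>z - b\<bar> + k * (b - a) + a)"

definition MC :: "real \<Rightarrow> real \<Rightarrow> nat \<Rightarrow> (nat \<Rightarrow> real) \<Rightarrow> real \<times> real \<Rightarrow> real" where
  "MC ob k n x = (\<lambda>(a, b). Max ((\<lambda>i. cost ob k a b (x i)) ` {1..n}))"

definition xl :: "real \<Rightarrow> nat \<Rightarrow> (nat \<Rightarrow> real) \<Rightarrow> real" where
  "xl ob n x = Min (x ` N1 ob n x)"

definition xr :: "real \<Rightarrow> nat \<Rightarrow> (nat \<Rightarrow> real) \<Rightarrow> real" where
  "xr ob n x = Max (x ` N1 ob n x)"

definition yl :: "real \<Rightarrow> real \<Rightarrow> nat \<Rightarrow> (nat \<Rightarrow> real) \<Rightarrow> real" where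
  "yl ob L n x = Min (x ` N2 ob L n x)"

definition yr :: "real \<Rightarrow> real \<Rightarrow> nat \<Rightarrow> (nat \<Rightarrow> real) \<Rightarrow> real" where
  "yr ob L n x = Max (x ` N2 ob L n x)"

definition optimal_edge ::
  "real \<Rightarrow> real \<Rightarrow> real \<Rightarrow> nat \<Rightarrow> (nat \<Rightarrow> real) \<Rightarrow> real \<times> real \<Rightarrow> bool" where
  "optimal_edge ob L k n x e \<longleftrightarrow> is_arg_min (MC ob k n x) (\<lambda>e. e \<in> edges ob L) e"

definition star_edge :: "real \<Rightarrow> real \<Rightarrow> nat \<Rightarrow> (nat \<Rightarrow> real) \<Rightarrow> real \<times> real" where
  "star_edge ob L n x =
     (if 1 - yr ob L n x \<ge> xl ob n x
      then ((xl ob n x + xr ob n x) / 2, (yl ob L n x - xl ob n x) / 2 + 1 / 2)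
      else ((xr ob n x - yr ob L n x) / 2 + 1 / 2, (yl ob L n x + yr ob L n x) / 2))"

text \<open>
  For \<open>k = 0\<close> the optimal edge need not be unique: with agents at \<open>1/5\<close> and \<open>7/10\<close> and the
  obstacle \<open>{1/2}\<close>, the edges \<open>(1/5, 3/4)\<close> and \<open>(1/10, 17/20)\<close> both have the least maximum cost
  \<open>1/4\<close>, and the first of them is the value of \<open>star_edge\<close>.
\<close>

lemma optimal_edge_not_unique:
  fixes x :: "nat \<Rightarrow> real"
  defines "x \<equiv> \<lambda>i. if i = 1 then 1 / 5 else 7 / 10"
  shows "location_profile (1 / 2) 0 2 x"
    and "star_edge (1 / 2) 0 2 x = (1 / 5, 3 / 4)"
    and "optimal_edge (1 / 2) 0 0 2 x (1 / 5, 3 / 4)"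
    and "optimal_edge (1 / 2) 0 0 2 x (1 / 10, 17 / 20)"
proof -
  have agents: "{1..2} = {1, 2 :: nat}" by auto
  have N: "N1 (1 / 2) 2 x = {1}" "N2 (1 / 2) 0 2 x = {2}"
    by (auto simp: N1_def N2_def x_def agents)
  show "location_profile (1 / 2) 0 2 x"
    unfolding location_profile_def N by (auto simp: x_def agents)
  show "star_edge (1 / 2) 0 2 x = (1 / 5, 3 / 4)"
    unfolding star_edge_def xl_def xr_def yl_def yr_def N by (simp add: x_def)
  have MC: "MC (1 / 2) 0 2 x (a, b) = max (\<bar>1 / 5 - a\<bar> + (1 - b)) (\<bar>7 / 10 - b\<bar> + a)" for a b
    unfolding MC_def agents by (simp add: cost_def x_def)
  have "1 / 4 \<le> MC (1 / 2) 0 2 x (a, b)" for a b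
    unfolding MC le_max_iff_disj by linarith
  then have least: "1 / 4 \<le> MC (1 / 2) 0 2 x e" for e
    by (cases e) simp
  have val: "MC (1 / 2) 0 2 x (1 / 5, 3 / 4) = 1 / 4" "MC (1 / 2) 0 2 x (1 / 10, 17 / 20) = 1 / 4"
    unfolding MC by simp_all
  have optimal: "optimal_edge (1 / 2) 0 0 2 x e"
    if "e \<in> edges (1 / 2) 0" "MC (1 / 2) 0 2 x e = 1 / 4" for e
    using that least unfolding optimal_edge_def is_arg_min_def by (metis not_less)
  show "optimal_edge (1 / 2) 0 0 2 x (1 / 5, 3 / 4)"
    and "optimal_edge (1 / 2) 0 0 2 x (1 / 10, 17 / 20)"
    by (rule optimal, simp add: edges_def, rule val)+
qed

end

theory Submission
  imports Defs
begin

text \<open>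
  Suppose \<open>1 - yr \<ge> xl\<close>. The costs at \<open>xr\<close>, \<open>xl\<close> and \<open>yl\<close> are bounded below by affine functions of
  \<open>(a, b)\<close>, and the convex combination of these with weights \<open>(1 - k) / 2\<close>, \<open>k\<close> and \<open>(1 - k) / 2\<close>
  is constant. This constant bounds the maximum cost from below. At the star edge all three functions
  take this value and no agent has a larger cost. If \<open>k > 0\<close>, all weights are positive, so an
  optimal edge makes all three functions equal, which determines \<open>a\<close> and \<open>b\<close>. The other case follows
  by the reflection \<open>z \<mapsto> 1 - z\<close>, which exchanges the two sides.
\<close>

text \<open>The points and coordinates are arbitrary reals, so the bound can be applied again to
  reflected data, with \<open>1 - b\<close> and \<open>1 - a\<close> in place of \<open>a\<close>
  and \<open>b\<close>.\<close>

lemma three_point_lower_bound: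
  fixes k l r u a b M :: real
  assumes k: "0 \<le> k" "k < 1"
    and r: "r - a + k * (b - a) + (1 - b) \<le> M"
    and l: "a - l + k * (b - a) + (1 - b) \<le> M"
    and u: "b - u + k * (b - a) + a \<le> M"
  defines "a' \<equiv> (l + r) / 2" and "b' \<equiv> (u - l) / 2 + 1 / 2"
  defines "C \<equiv> b' - u + k * (b' - a') + a'"
  shows "C \<le> M" and "k > 0 \<Longrightarrow> M = C \<Longrightarrow> a = a' \<and> b = b'"
proof -
  define R where "R = M - (r - a + k * (b - a) + (1 - b))"
  define S where "S = M - (a - l + k * (b - a) + (1 - b))"
  define T where "T = M - (b - u + k * (b - a) + a)"
  have slack: "R \<ge> 0" "S \<ge> 0" "T \<ge> 0"
    using r l u by (simp_all add: R_def S_def T_def)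
  \<comment> \<open>The weights add up to 1, and \<open>a\<close> and \<open>b\<close> cancel in the
    weighted sum of the three affine bounds.\<close>
  have sum: "M - C = (1 - k) / 2 * R + k * S + (1 - k) / 2 * T"
    by (simp add: C_def a'_def b'_def R_def S_def T_def field_simps)
  have nonneg: "(1 - k) / 2 * R \<ge> 0" "k * S \<ge> 0" "(1 - k) / 2 * T \<ge> 0"
    using k slack by simp_all
  show "C \<le> M" using sum nonneg by linarith
  show "a = a' \<and> b = b'" if "k > 0" "M = C"
  proof -
    have "(1 - k) / 2 * R = 0" "k * S = 0" "(1 - k) / 2 * T = 0"
      using sum nonneg \<open>M = C\<close> by linarith+
    then have "R = 0" "S = 0" "T = 0" using \<open>k > 0\<close> k by auto
    \<comment> \<open>The terms with \<open>k\<close> drop out of the differences, leaving a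
      triangular linear system for \<open>a - a'\<close> and \<open>b - b'\<close>.\<close>
    moreover have "R - S = 2 * (a - a')" "R - T = 2 * (a - a') + 2 * (b - b')"
      by (simp_all add: R_def S_def T_def a'_def b'_def field_simps)
    ultimately show ?thesis by simp
  qed
qed

theorem theorem3:
  fixes k ob L :: real and n :: nat and x :: "nat \<Rightarrow> real"
  assumes "0 \<le> k" and "k < 1"
    and "0 < ob" and "ob < 1"
    and "0 \<le> L" and "L < 1 - ob"
    and "location_profile ob L n x"
  shows "optimal_edge ob L k n x (star_edge ob L n x)
    \<and> (k > 0 \<longrightarrow> (\<forall>e. optimal_edge ob L k n x e \<longrightarrow> e = star_edge ob L n x))
    \<and> (case star_edge ob L n x of (a, b) \<Rightarrow>
         MC ob k n x (a, b) = cost ob k a b (xr ob n x)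
       \<and> MC ob k n x (a, b) = cost ob k a b (yl ob L n x))"
proof -
  note k = \<open>0 \<le> k\<close> \<open>k < 1\<close>
  define l r u v where "l = xl ob n x" and "r = xr ob n x"
    and "u = yl ob L n x" and "v = yr ob L n x"
  note lruv = l_def r_def u_def v_def
  define Z W where "Z = x ` N1 ob n x" and "W = x ` N2 ob L n x"
  have fin: "finite Z" "finite W" and ne: "Z \<noteq> {}" "W \<noteq> {}"
    using \<open>location_profile ob L n x\<close>
    by (auto simp: Z_def W_def N1_def N2_def location_profile_def)
  have agents: "x ` {1..n} = Z \<union> W"
    using \<open>location_profile ob L n x\<close>
    by (fastforce simp: Z_def W_def N1_def N2_def location_profile_def)
  have Z_dom: "z \<in> {0..<ob}" if "z \<in> Z" for z
    using that \<open>location_profile ob L n x\<close> \<open>0 \<le> L\<close>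
    by (fastforce simp: Z_def N1_def location_profile_def)
  have W_dom: "w \<in> {ob + L<..1}" if w: "w \<in> W" for w
  proof -
    obtain i where "i \<in> {1..n}" "w = x i" "ob + L < w"
      using w unfolding W_def N2_def by blast
    moreover have "x i \<in> {0..<ob} \<union> {ob + L<..1}"
      using \<open>location_profile ob L n x\<close> \<open>i \<in> {1..n}\<close> unfolding location_profile_def by blast
    ultimately show ?thesis using \<open>0 \<le> L\<close> by auto
  qed
  have ends: "l = Min Z" "r = Max Z" "u = Min W" "v = Max W"
    by (simp_all add: lruv xl_def xr_def yl_def yr_def Z_def W_def)
  have mem: "l \<in> Z" "r \<in> Z" "u \<in> W" "v \<in> W"
    using fin ne by (simp_all add: ends)
  have Z_bounds: "l \<le> z" "z \<le> r" if "z \<in> Z" for z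
    using that fin by (simp_all add: ends)
  have W_bounds: "u \<le> w" "w \<le> v" if "w \<in> W" for w
    using that fin by (simp_all add: ends)
  have ineqs: "0 \<le> l" "l \<le> r" "r < ob" "ob + L < u" "u \<le> v" "v \<le> 1"
    using mem Z_dom W_dom Z_bounds W_bounds by auto
  have costZ: "cost ob k a b z = \<bar>z - a\<bar> + k * (b - a) + (1 - b)" if "z \<in> Z" for a b z
    using Z_dom[OF that] by (simp add: cost_def)
  have costW: "cost ob k a b w = \<bar>w - b\<bar> + k * (b - a) + a" if "w \<in> W" for a b w
    using W_dom[OF that] \<open>0 \<le> L\<close> by (simp add: cost_def)
  have MC: "MC ob k n x (a, b) = Max (cost ob k a b ` (Z \<union> W))" for a b
    by (simp add: MC_def agents[symmetric] image_image)
  have MC_ge: "cost ob k a b z \<le> MC ob k n x (a, b)" if "z \<in> Z \<union> W" for a b z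
    using that fin unfolding MC by (intro Max_ge) auto
  have MC_eqI: "MC ob k n x (a, b) = C"
    if "\<And>z. z \<in> Z \<Longrightarrow> cost ob k a b z \<le> C" "\<And>w. w \<in> W \<Longrightarrow> cost ob k a b w \<le> C"
      "cost ob k a b r = C" for a b C
    using that mem fin unfolding MC by (intro Max_eqI) auto
  \<comment> \<open>Each absolute value is at least both of its signed versions. The bounds at
    \<open>r\<close> and \<open>u\<close> serve both cases below, the one at \<open>l\<close> only
    the first and the one at \<open>v\<close> only the second.\<close>
  have bounds:
    "r - a + k * (b - a) + (1 - b) \<le> MC ob k n x (a, b)"
    "a - l + k * (b - a) + (1 - b) \<le> MC ob k n x (a, b)"
    "b - u + k * (b - a) + a \<le> MC ob k n x (a, b)"
    "v - b + k * (b - a) + a \<le> MC ob k n x (a, b)" for a b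
    using MC_ge[of r a b] MC_ge[of l a b] MC_ge[of u a b] MC_ge[of v a b] mem costZ costW
    by auto
  obtain a' b' where star: "star_edge ob L n x = (a', b')" by fastforce
  define C where "C = b' - u + k * (b' - a') + a'"
  have "(a', b') \<in> edges ob L \<and> MC ob k n x (a', b') = C
      \<and> cost ob k a' b' r = C \<and> cost ob k a' b' u = C
      \<and> (\<forall>a b. C \<le> MC ob k n x (a, b)
           \<and> (k > 0 \<longrightarrow> MC ob k n x (a, b) = C \<longrightarrow> a = a' \<and> b = b'))"
  proof (cases "1 - v \<ge> l")
    case True
    then have eq: "a' = (l + r) / 2" "b' = (u - l) / 2 + 1 / 2"
      using star by (auto simp: star_edge_def lruv)
    then have lin: "2 * a' = l + r" "2 * b' = u - l + 1" by simp_all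
    \<comment> \<open>The case condition gives \<open>2 * b' \<ge> u + v\<close>, which keeps
      \<open>b'\<close> to the right of the obstacle.\<close>
    have "0 \<le> a'" "a' < ob" "ob + L < b'" "b' \<le> 1"
      using ineqs True lin by linarith+
    then have "(a', b') \<in> edges ob L" by (simp add: edges_def)
    moreover have r: "cost ob k a' b' r = C" and u: "cost ob k a' b' u = C"
      unfolding costZ[OF mem(2)] costW[OF mem(3)] C_def using ineqs True lin by linarith+
    \<comment> \<open>As \<open>a'\<close> is the midpoint of \<open>l\<close> and \<open>r\<close>,
      no point of \<open>Z\<close> is farther from it than \<open>r\<close>. As \<open>b'\<close> is
      at or beyond the midpoint of \<open>u\<close> and \<open>v\<close>, no point of
      \<open>W\<close> is farther from it than \<open>u\<close>.\<close>
    moreover have "MC ob k n x (a', b') = C"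
    proof (rule MC_eqI[OF _ _ r])
      show "cost ob k a' b' z \<le> C" if "z \<in> Z" for z
        unfolding costZ[OF that] C_def using Z_bounds[OF that] ineqs True lin by linarith
      show "cost ob k a' b' w \<le> C" if "w \<in> W" for w
        unfolding costW[OF that] C_def using W_bounds[OF that] ineqs True lin by linarith
    qed
    ultimately show ?thesis
      using three_point_lower_bound[OF k bounds(1-3)] unfolding C_def eq by blast
  next
    case False
    then have eq: "a' = (r - v) / 2 + 1 / 2" "b' = (u + v) / 2"
      using star by (auto simp: star_edge_def lruv)
    then have lin: "2 * a' = r - v + 1" "2 * b' = u + v" by simp_all
    \<comment> \<open>Here the case condition gives \<open>2 * a' < l + r\<close>, so
      \<open>a' < r\<close>; now \<open>r\<close> is farthest from \<open>a'\<close>, and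
      \<open>b'\<close> is a midpoint.\<close>
    have "0 \<le> a'" "a' < ob" "ob + L < b'" "b' \<le> 1"
      using ineqs False lin by linarith+
    then have "(a', b') \<in> edges ob L" by (simp add: edges_def)
    moreover have r: "cost ob k a' b' r = C" and u: "cost ob k a' b' u = C"
      unfolding costZ[OF mem(2)] costW[OF mem(3)] C_def using ineqs False lin by linarith+
    moreover have "MC ob k n x (a', b') = C"
    proof (rule MC_eqI[OF _ _ r])
      show "cost ob k a' b' z \<le> C" if "z \<in> Z" for z
        unfolding costZ[OF that] C_def using Z_bounds[OF that] ineqs False lin by linarith
      show "cost ob k a' b' w \<le> C" if "w \<in> W" for w
        unfolding costW[OF that] C_def using W_bounds[OF that] ineqs False lin by linarith
    qed
    moreover have "C \<le> MC ob k n x (a, b)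
        \<and> (k > 0 \<longrightarrow> MC ob k n x (a, b) = C \<longrightarrow> a = a' \<and> b = b')" for a b
    proof -
      \<comment> \<open>The minimizer of the three-point bound for \<open>1 - v\<close>,
        \<open>1 - u\<close>, \<open>1 - r\<close>, left unsimplified so that unfolding matches the
        instantiated lemma.\<close>
      let ?a = "(1 - v + (1 - u)) / 2" and ?b = "(1 - r - (1 - v)) / 2 + 1 / 2"
      have reflect: "?a = 1 - b'" "?b = 1 - a'"
        unfolding eq by (simp_all add: field_simps)
      \<comment> \<open>The reflected constant is the cost at \<open>r\<close>, which equals the
        cost at \<open>u\<close> at the star edge.\<close>
      have C: "?b - (1 - r) + k * (?b - ?a) + ?a = C"
        unfolding reflect C_def by (simp add: eq field_simps)
      have "(1 - u) - (1 - b) + k * ((1 - a) - (1 - b)) + (1 - (1 - a)) \<le> MC ob k n x (a, b)"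
        "(1 - b) - (1 - v) + k * ((1 - a) - (1 - b)) + (1 - (1 - a)) \<le> MC ob k n x (a, b)"
        "(1 - a) - (1 - r) + k * ((1 - a) - (1 - b)) + (1 - b) \<le> MC ob k n x (a, b)"
        using bounds[where a = a and b = b] by simp_all
      note reflected = three_point_lower_bound[OF k this, unfolded C, unfolded reflect]
      show ?thesis using reflected by auto
    qed
    ultimately show ?thesis by blast
  qed
  then have edge: "(a', b') \<in> edges ob L" and opt: "MC ob k n x (a', b') = C"
    and tight: "cost ob k a' b' r = C" "cost ob k a' b' u = C"
    and bound: "\<forall>a b. C \<le> MC ob k n x (a, b)
      \<and> (k > 0 \<longrightarrow> MC ob k n x (a, b) = C \<longrightarrow> a = a' \<and> b = b')"
    by blast+
  have least: "C \<le> MC ob k n x e"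
    and unique: "k > 0 \<longrightarrow> MC ob k n x e = C \<longrightarrow> e = (a', b')" for e
    using bound[rule_format, of "fst e" "snd e"] by (cases e, simp)+
  \<comment> \<open>The lower bound \<open>C\<close> is attained at an edge, so the minimizers are
    exactly the edges of value \<open>C\<close>.\<close>
  have optimal_iff: "optimal_edge ob L k n x e \<longleftrightarrow> e \<in> edges ob L \<and> MC ob k n x e = C" for e
  proof
    assume "optimal_edge ob L k n x e"
    then have "e \<in> edges ob L" "\<not> C < MC ob k n x e"
      using edge opt by (auto simp: optimal_edge_def is_arg_min_def)
    then show "e \<in> edges ob L \<and> MC ob k n x e = C"
      using least[of e] by simp
  next
    assume "e \<in> edges ob L \<and> MC ob k n x e = C"
    then show "optimal_edge ob L k n x e"
      using least by (simp add: optimal_edge_def is_arg_min_def not_less)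
  qed
  show ?thesis
    unfolding star optimal_iff prod.case r_def[symmetric] u_def[symmetric] opt tight
    using edge unique by blast
qed

end
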